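(* Let $p\geq 5$ be a fixed prime number, and suppose $q\geq 4$ is a power of a prime number. The group $\mathrm{PSL}_2(q)$ is $(2,p)$-generated if and only if one of the following conditions is satisfied: (i) $q\equiv 0\pmod p$; (ii) $q\equiv 1\pmod p$; or (iii) $q\equiv -1\pmod p$.
   Context: For a prime power $q$, $\mathbb{F}_q$ is the finite field with $q$ elements, $\mathrm{SL}_2(q)$ is the group of $2\times 2$ matrices over $\mathbb{F}_q$ of determinant $1$, and $\mathrm{PSL}_2(q)$ is the quotient of $\mathrm{SL}_2(q)$ by its centre $\{\pm I\}$. A group $G$ is said to be $(a,b)$-generated if there are two elements of $G$, of orders (exactly) $a$ and $b$ respectively, that together generate $G$. No relation is assumed between $p$ and the prime of which $q$ is a power. *)

theory Defs
  imports
    "HOL-Analysis.Analysis"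
    "HOL-Algebra.Generated_Groups"
    "HOL-Algebra.Multiplicative_Group"
    "HOL-Number_Theory.Number_Theory"
begin

definition centre :: "('g, 'm) monoid_scheme \<Rightarrow> 'g set" where
  "centre G = {z \<in> carrier G. \<forall>g \<in> carrier G. z \<otimes>\<^bsub>G\<^esub> g = g \<otimes>\<^bsub>G\<^esub> z}"

(* The field is the type 'a; for the finite field with q elements, 'a is a finite type with
   CARD('a) = q. *)
definition SL2 :: "('a::field ^ 2 ^ 2) monoid" where
  "SL2 = \<lparr>carrier = {A. det A = 1}, mult = (**), one = mat 1\<rparr>"

definition PSL2 :: "('a::field ^ 2 ^ 2) set monoid" where
  "PSL2 = SL2 Mod centre SL2"

definition two_generated :: "('g, 'm) monoid_scheme \<Rightarrow> nat \<Rightarrow> nat \<Rightarrow> bool" where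
  "two_generated G a b \<longleftrightarrow>
     (\<exists>x \<in> carrier G. \<exists>y \<in> carrier G.
        group.ord G x = a \<and> group.ord G y = b \<and> generate G {x, y} = carrier G)"

lemma group_SL2: "group (SL2 :: ('a::field ^ 2 ^ 2) monoid)"
proof (rule groupI)
  fix A :: "'a^2^2" assume "A \<in> carrier SL2"
  then have d: "det A = 1" by (simp add: SL2_def)
  then obtain B where B: "B ** A = mat 1"
    by (metis invertible_det_nz invertible_def zero_neq_one)
  then have "det B * det A = 1" by (metis det_mul det_I)
  with d B show "\<exists>B \<in> carrier SL2. B \<otimes>\<^bsub>SL2\<^esub> A = \<one>\<^bsub>SL2\<^esub>"
    by (auto simp: SL2_def)
qed (auto simp: SL2_def det_mul matrix_mul_assoc)

lemma mem_centre_SL2_iff: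
  "A \<in> centre (SL2 :: ('a::field ^ 2 ^ 2) monoid) \<longleftrightarrow> A = mat 1 \<or> A = - mat 1"
proof
  assume A: "A \<in> centre SL2"
  define U :: "'a^2^2" where "U = vector [vector [1, 1], vector [0, 1]]"
  define L :: "'a^2^2" where "L = vector [vector [1, 0], vector [1, 1]]"
  have "U \<in> carrier SL2" "L \<in> carrier SL2"
    by (simp_all add: SL2_def U_def L_def det_2)
  with A have "A ** U = U ** A" "A ** L = L ** A" and d: "det A = 1"
    by (auto simp: centre_def SL2_def)
  then have z: "A$1$2 = 0" "A$2$1 = 0" "A$1$1 = A$2$2"
    by (simp_all add: U_def L_def vec_eq_iff forall_2 matrix_matrix_mult_def sum_2)
  with d have "(A$2$2 - 1) * (A$2$2 + 1) = 0"
    by (simp add: det_2 algebra_simps)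
  then have "A$2$2 = 1 \<or> A$2$2 = - 1"
    by (simp add: eq_neg_iff_add_eq_0)
  with z show "A = mat 1 \<or> A = - mat 1"
    by (auto simp: vec_eq_iff forall_2 mat_def)
next
  assume "A = mat 1 \<or> A = - mat 1"
  then show "A \<in> centre SL2"
    by (auto simp: centre_def SL2_def det_2 vec_eq_iff forall_2 mat_def
        matrix_matrix_mult_def sum_2)
qed

lemma centre_SL2: "centre (SL2 :: ('a::field ^ 2 ^ 2) monoid) = {mat 1, - mat 1}"
  using mem_centre_SL2_iff by blast

lemma centre_normal:
  assumes "group G"
  shows "centre G \<lhd> G"
proof -
  interpret group G by fact
  have sub: "subgroup (centre G) G"
  proof (rule subgroupI)
    show "centre G \<noteq> {}" by (auto simp: centre_def intro!: exI[of _ "\<one>\<^bsub>G\<^esub>"])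
  next
    fix a assume a: "a \<in> centre G"
    then have ac: "a \<in> carrier G" by (simp add: centre_def)
    have "inv\<^bsub>G\<^esub> a \<otimes>\<^bsub>G\<^esub> g = g \<otimes>\<^bsub>G\<^esub> inv\<^bsub>G\<^esub> a" if g: "g \<in> carrier G" for g
    proof -
      have "g = a \<otimes>\<^bsub>G\<^esub> g \<otimes>\<^bsub>G\<^esub> inv\<^bsub>G\<^esub> a"
        using a ac g by (simp add: centre_def m_assoc)
      then have "inv\<^bsub>G\<^esub> a \<otimes>\<^bsub>G\<^esub> g = inv\<^bsub>G\<^esub> a \<otimes>\<^bsub>G\<^esub> (a \<otimes>\<^bsub>G\<^esub> g \<otimes>\<^bsub>G\<^esub> inv\<^bsub>G\<^esub> a)"
        by (rule arg_cong)
      also have "\<dots> = g \<otimes>\<^bsub>G\<^esub> inv\<^bsub>G\<^esub> a"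
        using ac g by (simp add: m_assoc[symmetric])
      finally show ?thesis .
    qed
    with ac show "inv\<^bsub>G\<^esub> a \<in> centre G" by (simp add: centre_def)
  next
    fix a b assume ab: "a \<in> centre G" "b \<in> centre G"
    have "a \<otimes>\<^bsub>G\<^esub> b \<otimes>\<^bsub>G\<^esub> g = g \<otimes>\<^bsub>G\<^esub> (a \<otimes>\<^bsub>G\<^esub> b)" if g: "g \<in> carrier G" for g
    proof -
      from ab g have c: "a \<in> carrier G" "b \<in> carrier G"
        and ag: "a \<otimes>\<^bsub>G\<^esub> g = g \<otimes>\<^bsub>G\<^esub> a" and bg: "b \<otimes>\<^bsub>G\<^esub> g = g \<otimes>\<^bsub>G\<^esub> b"
        unfolding centre_def by blast+
      have "a \<otimes>\<^bsub>G\<^esub> b \<otimes>\<^bsub>G\<^esub> g = a \<otimes>\<^bsub>G\<^esub> g \<otimes>\<^bsub>G\<^esub> b"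
        by (simp only: m_assoc c g bg)
      also have "\<dots> = g \<otimes>\<^bsub>G\<^esub> (a \<otimes>\<^bsub>G\<^esub> b)"
        by (simp only: ag m_assoc c g)
      finally show ?thesis .
    qed
    moreover have "a \<in> carrier G" "b \<in> carrier G" using ab by (simp_all only: centre_def mem_Collect_eq)
    ultimately show "a \<otimes>\<^bsub>G\<^esub> b \<in> centre G" by (simp add: centre_def)
  qed (auto simp: centre_def)
  show ?thesis
  proof (rule normal_invI[OF sub])
    fix x h assume x: "x \<in> carrier G" and h: "h \<in> centre G"
    then have "h \<in> carrier G" "x \<otimes>\<^bsub>G\<^esub> h = h \<otimes>\<^bsub>G\<^esub> x"
      unfolding centre_def by auto
    with x have "x \<otimes>\<^bsub>G\<^esub> h \<otimes>\<^bsub>G\<^esub> inv\<^bsub>G\<^esub> x = h" by (simp add: m_assoc)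
    with h show "x \<otimes>\<^bsub>G\<^esub> h \<otimes>\<^bsub>G\<^esub> inv\<^bsub>G\<^esub> x \<in> centre G" by simp
  qed
qed

lemma group_PSL2: "group (PSL2 :: ('a::field ^ 2 ^ 2) set monoid)"
  unfolding PSL2_def by (intro normal.factorgroup_is_group centre_normal group_SL2)

end

theory Submission
  imports Defs "HOL-Algebra.Sylow" "HOL-Decision_Procs.Algebra_Aux"
begin

text \<open>Since \<open>|SL\<^sub>2(q)| = q (q - 1) (q + 1)\<close>, the three congruences together say that the prime \<open>p\<close> divides the order of
\<open>SL\<^sub>2(q)\<close>. One direction is therefore Lagrange's theorem. For the other, Cauchy's theorem provides an element of order
\<open>p\<close>, and the task is to find generators. The classification of the subgroups of \<open>PSL\<^sub>2(q)\<close> is avoided by choosing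
generators for which the generated group \<open>H\<close> visibly contains a large subgroup.

By the Cayley-Hamilton theorem, \<open>Y\<^bsup>p\<^esup> = 1\<close> depends only on the trace of a nonscalar \<open>Y\<close> of
determinant one (lemma \<open>SL2_pow_eq_one_iff\<close>). So any nonscalar \<open>Y\<close> with the trace \<open>s\<close> of an element
of order \<open>p\<close> will do, and any noncentral \<open>X\<close> of trace zero and determinant one gives
an involution. This leaves the trace of the product of
\<open>X\<close> and \<open>Y\<close> free.

If \<open>q\<close> is prime, take \<open>Y = U X\<close> with the transvection \<open>U\<close>. Its powers are all the upper unipotent matrices, and these
together with any matrix that is not upper triangular generate the group
(lemma \<open>SL2_eq_if_upper_unipotents\<close>).

If \<open>q\<close> is not prime, take \<open>Y = X D\<close> where \<open>D = diag(w, 1 / w)\<close> for a generator \<open>w\<close> of the multiplicative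
group of the field, so that \<open>H\<close> contains the full diagonal torus \<open>T\<close>. If \<open>H\<close> contains a nondiagonal upper triangular
matrix, then it contains all upper unipotents and is everything
(lemma \<open>eq_carrier_if_nondiagonal_upper\<close>). Otherwise two matrices of \<open>H\<close> with lower rows \<open>(c, d)\<close> and
\<open>(c', d')\<close>, all four entries nonzero, lie in the same double coset of \<open>T\<close> as soon as \<open>d / c\<close> and \<open>d' / c'\<close>
agree modulo squares. The product of the diagonal entries is an invariant of the double coset, so it takes at most two
values on such matrices (one in characteristic two). But on the matrices \<open>X diag(t, 1 / t) X\<close> this product is a
nonconstant affine function of \<open>t\<^sup>2 + 1 / t\<^sup>2\<close>, which takes about \<open>q / 4\<close> values, or \<open>q / 2\<close> in
characteristic two. This is a contradiction unless \<open>q\<close> is small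
(lemma \<open>card_bound\<close>), and the surviving orders 4 and 9, where \<open>p\<close> must be 5, are excluded by computing these
values from the equation \<open>s\<^sup>2 + s = 1\<close>.\<close>

section \<open>Two by two matrices\<close>

definition mat2 :: "'a::zero \<Rightarrow> 'a \<Rightarrow> 'a \<Rightarrow> 'a \<Rightarrow> 'a ^ 2 ^ 2" where
  "mat2 a b c d = vector [vector [a, b], vector [c, d]]"

lemma mat2_nth [simp]:
  "mat2 a b c d $ 1 $ 1 = a" "mat2 a b c d $ 1 $ 2 = b"
  "mat2 a b c d $ 2 $ 1 = c" "mat2 a b c d $ 2 $ 2 = d"
  by (simp_all add: mat2_def)

lemma mat2_eq_iff [simp]:
  "mat2 a b c d = mat2 a' b' c' d' \<longleftrightarrow> a = a' \<and> b = b' \<and> c = c' \<and> d = d'"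
  by (auto simp: vec_eq_iff forall_2)

lemma mat2_eta: "mat2 (A$1$1) (A$1$2) (A$2$1) (A$2$2) = A"
  by (simp add: vec_eq_iff forall_2)

lemma mat2_cases: obtains a b c d where "A = mat2 a b c d"
  using mat2_eta by metis

lemma mat2_mult [simp]:
  "mat2 a b c d ** mat2 a' b' c' d' =
     mat2 (a * a' + b * c') (a * b' + b * d') (c * a' + d * c') (c * b' + d * d')"
  for a :: "'a::semiring_1"
  by (simp add: vec_eq_iff forall_2 matrix_matrix_mult_def sum_2)

lemma det_mat2 [simp]: "det (mat2 a b c d) = a * d - b * c"
  by (simp add: det_2)

lemma mat_1_eq_mat2: "mat 1 = mat2 1 0 0 1"
  by (auto simp: vec_eq_iff forall_2 mat_def)

lemma uminus_mat2: "- mat2 a b c d = mat2 (- a) (- b) (- c) (- d)"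
  by (auto simp: vec_eq_iff forall_2)

lemma carrier_SL2 [simp]: "A \<in> carrier SL2 \<longleftrightarrow> det A = 1"
  and mult_SL2 [simp]: "A \<otimes>\<^bsub>SL2\<^esub> B = A ** B"
  and one_SL2: "\<one>\<^bsub>SL2\<^esub> = mat2 1 0 0 1"
  by (simp_all add: SL2_def mat_1_eq_mat2)

lemma inv_SL2:
  fixes a :: "'a::field"
  assumes "a * d - b * c = 1"
  shows "inv\<^bsub>SL2\<^esub> (mat2 a b c d) = mat2 d (- b) (- c) a"
  using assms
  by (intro group.inv_equality[OF group_SL2]) (auto simp: one_SL2 algebra_simps)

lemma subgroup_SL2_mult:
  assumes "subgroup H SL2" "mat2 a b c d \<in> H" "mat2 a' b' c' d' \<in> H"
  shows "mat2 (a * a' + b * c') (a * b' + b * d') (c * a' + d * c') (c * b' + d * d') \<in> H"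
  using subgroup.m_closed[OF assms] by simp

lemma subgroup_SL2_det:
  assumes "subgroup H SL2" "mat2 a b c d \<in> H"
  shows "a * d - b * c = 1"
  using subgroup.mem_carrier[OF assms] by simp

lemma subgroup_SL2_inv:
  assumes "subgroup H SL2" "mat2 a b c d \<in> H"
  shows "mat2 d (- b) (- c) a \<in> H"
  using subgroup.m_inv_closed[OF assms] inv_SL2[OF subgroup_SL2_det[OF assms]] by simp

section \<open>Finite fields\<close>

text \<open>The cyclicity of the unit group, carried over to fields that are given as types.\<close>

lemma finite_field_primitive_element:
  obtains w :: "'a::{field, finite}" where "w \<noteq> 0" "\<And>x. x \<noteq> 0 \<Longrightarrow> \<exists>n::nat. x = w ^ n"
proof -
  have "finite (carrier (cring_class_ops :: 'a ring))"
    by (rule finite_subset[of _ UNIV]) auto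
  from field.finite_field_mult_group_has_gen[OF field_class this] obtain w :: 'a
    where w: "w \<in> carrier (mult_of cring_class_ops)"
      and gen: "carrier (mult_of cring_class_ops) = {w [^]\<^bsub>cring_class_ops\<^esub> i | i :: nat. i \<in> UNIV}"
    by blast
  have *: "carrier (mult_of (cring_class_ops :: 'a ring)) = UNIV - {0}"
    by (auto simp: carrier_class zero_class)
  show thesis
  proof
    show "w \<noteq> 0" using w * by auto
    show "\<exists>n::nat. x = w ^ n" if "x \<noteq> 0" for x
      using gen that unfolding * by (auto simp: power_class)
  qed
qed

lemma power_CARD_minus_one:
  fixes x :: "'a::{field, finite}"
  assumes "x \<noteq> 0"
  shows "x ^ (CARD('a) - 1) = 1"
proof -
  have "(\<Prod>y\<in>UNIV - {0}. x * y) = (\<Prod>y\<in>UNIV - {0}. y)"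
    by (rule prod.reindex_bij_witness[of _ "\<lambda>y. y / x" "\<lambda>y. x * y"]) (use assms in auto)
  then have "x ^ (CARD('a) - 1) * (\<Prod>y\<in>UNIV - {0}. y) = (\<Prod>y\<in>UNIV - {0}. y)"
    by (simp add: prod.distrib card_Diff_singleton)
  moreover have "(\<Prod>y\<in>UNIV - {0 :: 'a}. y) \<noteq> 0" by simp
  ultimately show ?thesis by simp
qed

lemma CARD_le_if_power_eq_one:
  fixes w :: "'a::{field, finite}"
  assumes prim: "\<And>x. x \<noteq> 0 \<Longrightarrow> \<exists>n::nat. x = w ^ n" and w: "w ^ m = 1" "m > 0"
  shows "CARD('a) \<le> m + 1"
proof -
  have "UNIV \<subseteq> insert 0 ((\<lambda>i. w ^ i) ` {..<m})"
  proof
    fix x :: 'a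
    show "x \<in> insert 0 ((\<lambda>i. w ^ i) ` {..<m})"
    proof (cases "x = 0")
      case False
      then obtain n where "x = w ^ n" using prim by blast
      also have "\<dots> = w ^ (m * (n div m) + n mod m)" by simp
      also have "\<dots> = w ^ (n mod m)" unfolding power_add power_mult w by simp
      finally show ?thesis using w(2) by auto
    qed simp
  qed
  then have "CARD('a) \<le> card (insert 0 ((\<lambda>i. w ^ i) ` {..<m}))" by (intro card_mono) auto
  also have "\<dots> \<le> Suc (card ((\<lambda>i. w ^ i) ` {..<m}))" by (rule card_insert_le_m1) auto
  also have "\<dots> \<le> m + 1" using card_image_le[of "{..<m}" "\<lambda>i. w ^ i"] by simp
  finally show ?thesis .
qed

lemma of_nat_CARD: "of_nat CARD('a) = (0 :: 'a::{field, finite})"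
  using of_nat_eq_0_iff_char_dvd CHAR_dvd_CARD by blast

text \<open>When the order of the field is a prime, it equals the characteristic, so the multiples of one are pairwise
distinct until they exhaust the field. This is what lets a single transvection generate a whole root subgroup.\<close>

lemma prime_field_of_nat:
  assumes "prime CARD('a::{field, finite})"
  shows "\<exists>n. x = (of_nat n :: 'a)"
proof -
  have "CHAR('a) = CARD('a)"
    using CHAR_dvd_CARD[where ?'a = 'a] assms by (metis CHAR_not_1 One_nat_def prime_nat_iff)
  then have "inj_on (of_nat :: nat \<Rightarrow> 'a) {..<CARD('a)}"
    by (auto simp: inj_on_def of_nat_eq_iff_cong_CHAR unique_euclidean_semiring_class.cong_def)
  then have "card ((of_nat :: nat \<Rightarrow> 'a) ` {..<CARD('a)}) = CARD('a)"
    by (simp add: card_image)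
  then have "(of_nat :: nat \<Rightarrow> 'a) ` {..<CARD('a)} = UNIV"
    by (intro card_subset_eq) auto
  then show ?thesis by (metis UNIV_I imageE)
qed

text \<open>The squares have index at most two in the cyclic unit group, so two nonsquares lie in the same coset.\<close>

lemma divide_nonsquares_square:
  fixes x y :: "'a::{field, finite}"
  assumes "\<nexists>z. x = z\<^sup>2" "\<nexists>z. y = z\<^sup>2"
  shows "\<exists>z. x / y = z\<^sup>2"
proof -
  obtain w :: 'a where w: "w \<noteq> 0" "\<And>x. x \<noteq> 0 \<Longrightarrow> \<exists>n::nat. x = w ^ n"
    using finite_field_primitive_element by blast
  have odd_power: "\<exists>n. x = w * (w ^ n)\<^sup>2" if "\<nexists>z. x = z\<^sup>2" for x
  proof -
    have "x \<noteq> 0" using that by (metis zero_power2)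
    then obtain n where n: "x = w ^ n" using w by blast
    then have "odd n" using that by (metis evenE mult.commute power_mult)
    then show ?thesis using n by (elim oddE) (auto simp: power_mult mult.commute power_add)
  qed
  obtain m n where "x = w * (w ^ m)\<^sup>2" "y = w * (w ^ n)\<^sup>2"
    using odd_power assms by meson
  then have "x / y = (w ^ m / w ^ n)\<^sup>2" using w by (simp add: power_divide)
  then show ?thesis by blast
qed

lemma square_surj_char_2:
  fixes x :: "'a::{field, finite}"
  assumes "(2 :: 'a) = 0"
  shows "\<exists>z. x = z\<^sup>2"
proof -
  have "inj (\<lambda>z :: 'a. z\<^sup>2)"
  proof (rule injI)
    fix u v :: 'a assume "u\<^sup>2 = v\<^sup>2"
    then have "(u - v)\<^sup>2 = 2 * (v\<^sup>2 - u * v)" by (simp add: power2_eq_square algebra_simps)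
    then show "u = v" using assms by simp
  qed
  then show ?thesis using finite_UNIV_inj_surj by (metis surjD finite)
qed

text \<open>This makes the additive group generated by a nonzero \<open>l\<close> and all its multiples by squares equal to the
whole field. In odd characteristic \<open>x = ((x + 1) / 2)\<^sup>2 - ((x - 1) / 2)\<^sup>2\<close>; in characteristic two, squaring is
already surjective.\<close>

lemma difference_of_squares:
  obtains u v :: "'a::{field, finite}" where "x = u\<^sup>2 - v\<^sup>2"
proof (cases "(2 :: 'a) = 0")
  case True
  then show thesis using that[of _ 0] square_surj_char_2[of x] by auto
next
  case False
  have "((x + 1) / 2)\<^sup>2 - ((x - 1) / 2)\<^sup>2 = 4 * x / 4"
    by (simp add: power_divide power2_eq_square algebra_simps flip: diff_divide_distrib)
  moreover have "(4 :: 'a) \<noteq> 0"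
    using False by (metis mult_2 mult_eq_0_iff numeral_Bit0 numeral_code(2))
  ultimately show thesis using that[of "(x + 1) / 2" "(x - 1) / 2"] by simp
qed

section \<open>The order of the special linear group\<close>

text \<open>Solving \<open>a * d - b * c = 1\<close> for \<open>d\<close> when \<open>a \<noteq> 0\<close>, and for \<open>b\<close> when \<open>a = 0\<close>, parametrises the
group by two families whose sizes are evident.\<close>

lemma det_one_matrices_eq:
  "{A :: 'a::field ^ 2 ^ 2. det A = 1} =
     (\<lambda>(a, b, c). mat2 a b c ((1 + b * c) / a)) ` ((UNIV - {0}) \<times> UNIV \<times> UNIV) \<union>
     (\<lambda>(c, d). mat2 0 (- inverse c) c d) ` ((UNIV - {0}) \<times> UNIV)" (is "?L = ?R1 \<union> ?R2")
proof (rule Set.set_eqI, rule iffI)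
  fix A :: "'a^2^2" assume A: "A \<in> ?L"
  obtain a b c d where Ae: "A = mat2 a b c d" by (rule mat2_cases)
  show "A \<in> ?R1 \<union> ?R2"
  proof (cases "a = 0")
    case True
    with A Ae have bc: "- (b * c) = 1" by simp
    then have c: "c \<noteq> 0" by auto
    with bc have "b = - inverse c" by (metis mult_minus_left inverse_unique minus_minus mult.commute)
    with True c Ae show ?thesis by auto
  next
    case False
    with A Ae have "d = (1 + b * c) / a" by (simp add: field_simps)
    with Ae have "A = (\<lambda>(a, b, c). mat2 a b c ((1 + b * c) / a)) (a, b, c)" by simp
    with False show ?thesis by blast
  qed
qed (auto split: if_splits, metis left_inverse)

lemma order_SL2:
  "order (SL2 :: ('a::{field, finite} ^ 2 ^ 2) monoid) = CARD('a) * (CARD('a) - 1) * (CARD('a) + 1)"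
proof -
  let ?q = "CARD('a)"
  let ?R1 = "(\<lambda>(a, b, c). mat2 a b c ((1 + b * c) / a)) ` ((UNIV - {0 :: 'a}) \<times> UNIV \<times> UNIV)"
  let ?R2 = "(\<lambda>(c, d). mat2 0 (- inverse c) c d) ` ((UNIV - {0 :: 'a}) \<times> UNIV)"
  have "card ?R1 = card ((UNIV - {0 :: 'a}) \<times> (UNIV :: 'a set) \<times> (UNIV :: 'a set))"
    by (intro card_image) (auto simp: inj_on_def)
  moreover have "card ?R2 = card ((UNIV - {0 :: 'a}) \<times> (UNIV :: 'a set))"
    by (intro card_image) (auto simp: inj_on_def)
  moreover have "card (?R1 \<union> ?R2) = card ?R1 + card ?R2"
    by (intro card_Un_disjoint) auto
  ultimately have "card (?R1 \<union> ?R2) = (?q - 1) * (?q * ?q) + (?q - 1) * ?q"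
    by (simp add: card_cartesian_product card_Diff_singleton)
  then show ?thesis
    by (simp add: order_def SL2_def det_one_matrices_eq algebra_simps)
qed

lemma finite_carrier_SL2: "finite (carrier (SL2 :: ('a::{field, finite} ^ 2 ^ 2) monoid))"
  by (rule finite_subset[of _ UNIV]) auto

text \<open>Cauchy's theorem, by applying Sylow's theorem with exponent one: a subgroup of order \<open>p\<close> consists of
the identity and elements of order \<open>p\<close>.\<close>

lemma (in group) exists_ord_eq_prime:
  assumes "prime p" "p dvd order G" "finite (carrier G)"
  shows "\<exists>y \<in> carrier G. ord y = p"
proof -
  obtain m where "order G = p ^ 1 * m" using assms(2) by auto
  with sylow_thm[OF assms(1) is_group this assms(3)]
  obtain H where H: "subgroup H G" "card H = p" by auto
  have "card H > 1" using H assms(1) prime_gt_1_nat by simp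
  then obtain y where y: "y \<in> H" "y \<noteq> \<one>"
    by (metis card_le_Suc0_iff_eq card.infinite le_numeral_extra(4) less_numeral_extra(4) not_one_less_zero One_nat_def not_less)
  have yG: "y \<in> carrier G" using H y subgroup.mem_carrier by metis
  interpret S: group "G\<lparr>carrier := H\<rparr>" using H(1) subgroup.subgroup_is_group[OF H(1)] by simp
  have "y [^] card H = \<one>"
    using S.pow_order_eq_1[of y] y(1) by (simp add: order_def flip: nat_pow_consistent)
  then have "ord y dvd p" using pow_eq_id[OF yG] H(2) by simp
  moreover have "ord y \<noteq> 1" using ord_eq_1[OF yG] y by simp
  ultimately show ?thesis using assms(1) yG prime_nat_iff by blast
qed

section \<open>Traces of elements of prime order\<close>

text \<open>\<open>cheb s n\<close> is the Chebyshev polynomial of the second kind \<open>U\<^bsub>n - 1\<^esub>(s / 2)\<close>, in the scaling that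
makes sense in every characteristic. For \<open>s = z + 1 / z\<close> with \<open>z\<^sup>2 \<noteq> 1\<close> its value is
\<open>(z ^ n - 1 / z ^ n) / (z - 1 / z)\<close>.\<close>

fun cheb :: "'a::comm_ring_1 \<Rightarrow> nat \<Rightarrow> 'a" where
  "cheb s 0 = 0"
| "cheb s (Suc 0) = 1"
| "cheb s (Suc (Suc n)) = s * cheb s (Suc n) - cheb s n"

text \<open>The Cayley-Hamilton relation \<open>A\<^sup>2 = s A - 1\<close> turns a power of \<open>A\<close> into a combination of \<open>A\<close> and the
identity whose coefficients obey the Chebyshev recursion.\<close>

lemma SL2_pow_Suc:
  fixes a :: "'a::field"
  assumes det: "a * d - b * c = 1" and s: "s = a + d"
  shows "mat2 a b c d [^]\<^bsub>SL2\<^esub> Suc n =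
    mat2 (cheb s (Suc n) * a - cheb s n) (cheb s (Suc n) * b)
         (cheb s (Suc n) * c) (cheb s (Suc n) * d - cheb s n)"
proof (induction n)
  case 0
  show ?case by (simp add: one_SL2)
next
  case (Suc n)
  have step: "(C * a - E) * a + C * b * c = (s * C - E) * a - C"
    "(C * a - E) * b + C * b * d = (s * C - E) * b"
    "C * c * a + (C * d - E) * c = (s * C - E) * c"
    "C * c * b + (C * d - E) * d = (s * C - E) * d - C" for C E
  proof -
    have "(C * a - E) * a + C * b * c = (s * C - E) * a - C * (a * d - b * c)"
      "C * c * b + (C * d - E) * d = (s * C - E) * d - C * (a * d - b * c)"
      by (simp_all add: s algebra_simps)
    then show "(C * a - E) * a + C * b * c = (s * C - E) * a - C"
      "C * c * b + (C * d - E) * d = (s * C - E) * d - C"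
      by (simp_all add: det)
  qed (simp_all add: s algebra_simps)
  have "mat2 a b c d [^]\<^bsub>SL2\<^esub> Suc (Suc n) = mat2 a b c d [^]\<^bsub>SL2\<^esub> Suc n ** mat2 a b c d"
    by simp
  also have "\<dots> = mat2 (cheb s (Suc (Suc n)) * a - cheb s (Suc n)) (cheb s (Suc (Suc n)) * b)
      (cheb s (Suc (Suc n)) * c) (cheb s (Suc (Suc n)) * d - cheb s (Suc n))"
    unfolding Suc.IH mat2_mult cheb.simps step by (rule refl)
  finally show ?case .
qed

text \<open>For a nonscalar matrix, whether its \<open>n\<close>-th power is the identity is a property of the trace alone, because
such a matrix and the identity are linearly independent. Hence an element of order \<open>p\<close>, once one is known
to exist, may be replaced by any nonscalar matrix of the same trace, which can be placed where it is
convenient. No eigenvalues are used, so elements whose eigenvalues lie only in the quadratic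
extension need no separate treatment.\<close>

lemma SL2_pow_eq_one_iff:
  fixes a :: "'a::field"
  assumes "a * d - b * c = 1" "\<not> (b = 0 \<and> c = 0 \<and> a = d)" "n > 0"
  shows "mat2 a b c d [^]\<^bsub>SL2\<^esub> n = \<one>\<^bsub>SL2\<^esub> \<longleftrightarrow>
    cheb (a + d) n = 0 \<and> cheb (a + d) (n - 1) = - 1"
proof -
  obtain m where n: "n = Suc m" using assms(3) by (cases n) auto
  have "C * a - E = 1 \<and> C * b = 0 \<and> C * c = 0 \<and> C * d - E = 1 \<longleftrightarrow> C = 0 \<and> E = - 1" for C E
  proof
    assume *: "C * a - E = 1 \<and> C * b = 0 \<and> C * c = 0 \<and> C * d - E = 1"
    then have "C * a = C * d" by (metis diff_add_cancel)
    with * assms(2) have "C = 0" by auto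
    with * show "C = 0 \<and> E = - 1" by (metis mult_zero_left diff_0 minus_minus)
  qed simp
  then show ?thesis
    unfolding n SL2_pow_Suc[OF assms(1) refl] one_SL2 by simp
qed

text \<open>Trace \<open>0\<close> forces order dividing four, and trace \<open>1\<close> or \<open>- 1\<close> forces order dividing six; both are
incompatible with a prime order that is at least five.\<close>

lemma SL2_ord_prime_trace:
  fixes a :: "'a::field"
  assumes p: "prime p" "p \<ge> 5" and det: "a * d - b * c = 1"
    and ord: "group.ord SL2 (mat2 a b c d) = p"
  shows "a + d \<noteq> 0" "(a + d)\<^sup>2 \<noteq> 1" "cheb (a + d) p = 0" "cheb (a + d) (p - 1) = - 1"
proof -
  interpret group "SL2 :: ('a ^ 2 ^ 2) monoid" by (rule group_SL2)
  let ?y = "mat2 a b c d"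
  have y: "?y \<in> carrier SL2" using det by simp
  have pow: "?y [^]\<^bsub>SL2\<^esub> n = \<one>\<^bsub>SL2\<^esub> \<longleftrightarrow> p dvd n" for n :: nat
    using pow_eq_id[OF y] ord by simp
  have p46: "\<not> p dvd 4" "\<not> p dvd 6"
  proof -
    show "\<not> p dvd 4" using p(2) by (auto dest: dvd_imp_le)
    have "p \<noteq> 6" "p \<noteq> 5 \<or> \<not> 5 dvd (6 :: nat)" using p(1) by auto
    then show "\<not> p dvd 6" using p(2) dvd_imp_le[of p 6] by (cases "p = 5") auto
  qed
  have ns: "\<not> (b = 0 \<and> c = 0 \<and> a = d)"
  proof
    assume "b = 0 \<and> c = 0 \<and> a = d"
    then have "?y [^]\<^bsub>SL2\<^esub> (2 :: nat) = \<one>\<^bsub>SL2\<^esub>"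
      using det by (simp add: eval_nat_numeral one_SL2)
    then have "p dvd 2" using pow by simp
    then show False using p(2) by (auto dest: dvd_imp_le)
  qed
  note iff = SL2_pow_eq_one_iff[OF det ns]
  show "cheb (a + d) p = 0" "cheb (a + d) (p - 1) = - 1"
    using pow[of p] iff[of p] p by auto
  show "a + d \<noteq> 0"
    using pow[of 4] iff[of 4] p46 by (auto simp: eval_nat_numeral)
  have "cheb s 6 = 0 \<and> cheb s 5 = - 1" if "s\<^sup>2 = 1" for s :: 'a
    using that by (auto simp: eval_nat_numeral power2_eq_1_iff)
  then show "(a + d)\<^sup>2 \<noteq> 1"
    using pow[of 6] iff[of 6] p46 by auto
qed

text \<open>If the trace \<open>r\<close> of one element of order \<open>p\<close> satisfies \<open>r\<^sup>2 = z\<close>, then its square, which has trace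
\<open>r\<^sup>2 - 2\<close>, is used instead: \<open>(r\<^sup>2 - 2)\<^sup>2 - r\<^sup>2 = (r\<^sup>2 - 4) * (r\<^sup>2 - 1)\<close>, and neither factor vanishes.\<close>

lemma exists_trace_of_order:
  fixes z :: "'a::{field, finite}"
  assumes p: "prime p" "p \<ge> 5" "p dvd order (SL2 :: ('a ^ 2 ^ 2) monoid)" and z: "z \<noteq> 4"
  obtains s :: 'a where "s \<noteq> 0" "s\<^sup>2 \<noteq> z" "cheb s p = 0" "cheb s (p - 1) = - 1"
proof -
  interpret group "SL2 :: ('a ^ 2 ^ 2) monoid" by (rule group_SL2)
  obtain y :: "'a ^ 2 ^ 2" where y: "y \<in> carrier SL2" "ord y = p"
    using exists_ord_eq_prime[OF p(1,3) finite_carrier_SL2] by blast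
  obtain a b c d where ye: "y = mat2 a b c d" by (rule mat2_cases)
  have det: "a * d - b * c = 1" using y ye by simp
  note tr = SL2_ord_prime_trace[OF p(1,2) det y(2)[unfolded ye]]
  show thesis
  proof (cases "(a + d)\<^sup>2 = z")
    case False
    then show thesis using tr by (intro that[of "a + d"])
  next
    case True
    let ?y2 = "y \<otimes>\<^bsub>SL2\<^esub> y"
    have y2: "?y2 \<in> carrier SL2" using y by (intro m_closed)
    have y2_pow: "y [^]\<^bsub>SL2\<^esub> (2 :: nat) = ?y2"
      using y by (simp add: numeral_2_eq_2 del: mult_SL2)
    then have "?y2 [^]\<^bsub>SL2\<^esub> p = (y [^]\<^bsub>SL2\<^esub> (2 :: nat)) [^]\<^bsub>SL2\<^esub> p" by simp
    also have "\<dots> = (y [^]\<^bsub>SL2\<^esub> p) [^]\<^bsub>SL2\<^esub> (2 :: nat)"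
      using y by (simp only: nat_pow_pow mult.commute)
    also have "\<dots> = \<one>\<^bsub>SL2\<^esub>" using pow_ord_eq_1[OF y(1)] y(2) by (simp only: nat_pow_one)
    finally have "ord ?y2 dvd p" using pow_eq_id[OF y2] by simp
    moreover have "?y2 \<noteq> \<one>\<^bsub>SL2\<^esub>"
    proof
      assume "?y2 = \<one>\<^bsub>SL2\<^esub>"
      then have "p dvd 2" using pow_eq_id[OF y(1)] y(2) y2_pow by metis
      then show False using p(2) by (auto dest: dvd_imp_le)
    qed
    then have "ord ?y2 \<noteq> 1" using ord_eq_1[OF y2] by simp
    ultimately have ord2: "ord ?y2 = p" using p(1) prime_nat_iff by blast
    define s where "s = (a + d)\<^sup>2 - 2"
    have e2: "?y2 = mat2 (a * a + b * c) (a * b + b * d) (c * a + d * c) (c * b + d * d)"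
      by (simp add: ye)
    have "det ?y2 = 1" using y2 by simp
    then have det2: "(a * a + b * c) * (c * b + d * d) - (a * b + b * d) * (c * a + d * c) = 1"
      unfolding e2 by simp
    have "(a * a + b * c) + (c * b + d * d) = (a + d)\<^sup>2 - 2 * (a * d - b * c)"
      by (simp add: power2_eq_square algebra_simps)
    then have tr2: "(a * a + b * c) + (c * b + d * d) = s" by (simp add: s_def det)
    note t2 = SL2_ord_prime_trace[OF p(1,2) det2 ord2[unfolded e2], unfolded tr2]
    have "s\<^sup>2 - z = (z - 4) * ((a + d)\<^sup>2 - 1)"
      unfolding s_def True by (simp add: power2_eq_square algebra_simps)
    then have "s\<^sup>2 \<noteq> z" using z tr(2) by auto
    then show thesis using t2 by (intro that[of s])
  qed
qed

text \<open>Writing \<open>s = u + 1 / u\<close>, the equation is the vanishing of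
\<open>u ^ 4 + u ^ 3 + u\<^sup>2 + u + 1\<close> divided by \<open>u\<^sup>2\<close>. The two hypotheses have \<open>s\<^sup>2 + s - 1\<close> as their
greatest common divisor.\<close>

lemma cheb_5_golden:
  fixes s :: "'a::field"
  assumes "cheb s 5 = 0" "cheb s 4 = - 1"
  shows "s\<^sup>2 + s = 1"
proof -
  have c5: "(s\<^sup>2 + s - 1) * (s\<^sup>2 - s - 1) = 0" and c4: "(s\<^sup>2 + s - 1) * (s - 1) = 0"
    using assms by (simp_all add: eval_nat_numeral algebra_simps)
  show ?thesis
  proof (rule ccontr)
    assume "s\<^sup>2 + s \<noteq> 1"
    then have "s\<^sup>2 - s - 1 = 0" "s = 1" using c5 c4 by auto
    then show False by simp
  qed
qed

section \<open>Subgroups that contain a root subgroup or a torus\<close>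

text \<open>Multiplying by upper unipotents on both sides changes the diagonal entries of a matrix with lower left entry
\<open>h \<noteq> 0\<close> at will, so such a matrix lies in \<open>H\<close> as soon as some element of \<open>H\<close> has that same entry
\<open>h\<close>. Conjugates of upper unipotents by the given element provide every \<open>h \<noteq> 0\<close>. An upper triangular
matrix is a quotient of two matrices with nonzero lower left entry.\<close>

lemma SL2_eq_if_upper_unipotents:
  fixes H :: "('a::field ^ 2 ^ 2) set"
  assumes H: "subgroup H SL2" and U: "\<And>x. mat2 1 x 0 1 \<in> H"
    and X: "mat2 a b c d \<in> H" and c: "c \<noteq> 0"
  shows "H = carrier SL2"
proof -
  have same_corner: "mat2 e' f' h g' \<in> H"
    if "mat2 e f h g \<in> H" "h \<noteq> 0" "e' * g' - f' * h = 1" for e f h g e' f' g'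
  proof -
    define x y where "x = (e' - e) / h" and "y = (g' - g) / h"
    have "mat2 (e + x * h) ((e + x * h) * y + (f + x * g)) h (h * y + g) \<in> H"
      using subgroup_SL2_mult[OF H subgroup_SL2_mult[OF H U[of x] that(1)] U[of y]] by simp
    moreover have e: "e + x * h = e'" and g: "h * y + g = g'"
      using that(2) by (simp_all add: x_def y_def)
    moreover have "(e + x * h) * y + (f + x * g) = f'"
    proof -
      have "(e + x * h) * (h * y + g) - ((e + x * h) * y + (f + x * g)) * h = e * g - f * h"
        by (simp add: algebra_simps)
      also have "\<dots> = e' * g' - f' * h"
        using subgroup_SL2_det[OF H that(1)] that(3) by simp
      finally show ?thesis using that(2) e g by simp
    qed
    ultimately show ?thesis by simp
  qed
  have lower: "mat2 e f h g \<in> H" if "h \<noteq> 0" "e * g - f * h = 1" for e f h g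
  proof -
    (* The conjugate of the unipotent with entry x has lower left entry - c\<^sup>2 * x. *)
    define x where "x = - h / c\<^sup>2"
    have "\<exists>e f g. mat2 e f (c * d - (c * x + d) * c) g \<in> H"
      using subgroup_SL2_mult[OF H subgroup_SL2_mult[OF H X U[of x]] subgroup_SL2_inv[OF H X]]
      by auto
    moreover have "c * d - (c * x + d) * c = h"
      using c by (simp add: x_def power2_eq_square field_simps)
    ultimately show ?thesis using same_corner that by metis
  qed
  have "mat2 e f h g \<in> H" if "e * g - f * h = 1" for e f h g
  proof (cases "h = 0")
    case True
    with that have g: "g \<noteq> 0" and eg: "e * g = 1" by auto
    have det: "a * d - b * c = 1" using subgroup_SL2_det[OF H X] .
    have "mat2 (e * d - f * c) (- e * b + f * a) (- g * c) (g * a) \<in> H"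
    proof (rule lower)
      have "(e * d - f * c) * (g * a) - (- e * b + f * a) * (- g * c)
          = (e * g) * (a * d - b * c)" by (simp add: algebra_simps)
      then show "(e * d - f * c) * (g * a) - (- e * b + f * a) * (- g * c) = 1"
        using eg det by simp
    qed (use c g in simp)
    from subgroup_SL2_mult[OF H this X]
    have "mat2 (e * (a * d - b * c)) (f * (a * d - b * c)) 0 (g * (a * d - b * c)) \<in> H"
      by (simp add: algebra_simps)
    then show ?thesis using True det by simp
  qed (use lower that in blast)
  then have "carrier SL2 \<subseteq> H" by (metis carrier_SL2 det_mat2 mat2_cases subsetI)
  then show ?thesis using subgroup.subset[OF H] by blast
qed

lemma card_le_twice_card_image:
  assumes "finite A" "\<And>y. card {x \<in> A. f x = y} \<le> 2"
  shows "card A \<le> 2 * card (f ` A)"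
proof -
  have "card A = card (\<Union>y\<in>f ` A. {x \<in> A. f x = y})"
    by (rule arg_cong[where f = card]) auto
  also have "\<dots> \<le> (\<Sum>y\<in>f ` A. card {x \<in> A. f x = y})"
    by (intro card_UN_le) (use assms in auto)
  also have "\<dots> \<le> (\<Sum>y\<in>f ` A. 2)" by (intro sum_mono assms)
  finally show ?thesis by simp
qed

lemma card_le_2_if_two_values:
  assumes "\<And>x. x \<in> A \<Longrightarrow> x = u \<or> x = v"
  shows "card A \<le> 2"
proof -
  have "card A \<le> card {u, v}" using assms by (intro card_mono) auto
  also have "\<dots> \<le> 2" by (rule card_insert_le_m1) auto
  finally show ?thesis .
qed

locale torus_overgroup =
  fixes H :: "('a::{field, finite} ^ 2 ^ 2) set"
  assumes subgroup: "subgroup H SL2"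
    and torus: "t \<noteq> 0 \<Longrightarrow> mat2 t 0 0 (inverse t) \<in> H"

begin

lemmas mult_closed = subgroup_SL2_mult[OF subgroup]
  and inv_closed = subgroup_SL2_inv[OF subgroup]
  and det_eq = subgroup_SL2_det[OF subgroup]

text \<open>A nondiagonal upper triangular matrix, multiplied by a torus element, becomes a nontrivial upper
unipotent. Conjugation by the torus multiplies its off-diagonal entry by an arbitrary nonzero square, and differences
of squares exhaust the field, so all upper unipotents are in \<open>H\<close>.\<close>

lemma eq_carrier_if_nondiagonal_upper:
  assumes X: "mat2 a b c d \<in> H" "c \<noteq> 0" and up: "mat2 e f 0 g \<in> H" "f \<noteq> 0"
  shows "H = carrier SL2"
proof (rule SL2_eq_if_upper_unipotents[OF subgroup _ X])
  fix x
  have eg: "e * g = 1" using det_eq[OF up(1)] by simp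
  then have g: "g \<noteq> 0" and ge: "inverse g = e" by (auto intro: inverse_unique simp: mult.commute)
  define l where "l = f * e"
  have l: "l \<noteq> 0" using up(2) eg by (auto simp: l_def)
  have unip: "mat2 1 l 0 1 \<in> H"
    using mult_closed[OF up(1) torus[OF g]] eg ge by (simp add: l_def mult.commute)
  have scale: "mat2 1 (l * t\<^sup>2) 0 1 \<in> H" for t
  proof (cases "t = 0")
    case True
    then show ?thesis using torus[of 1] by simp
  next
    case False
    have "mat2 (inverse t) 0 0 t \<in> H" using torus[of "inverse t"] False by simp
    from mult_closed[OF mult_closed[OF torus[OF False] unip] this]
    show ?thesis using False by (simp add: power2_eq_square mult_ac)
  qed
  obtain u v where uv: "x / l = u\<^sup>2 - v\<^sup>2" by (rule difference_of_squares)
  have "mat2 1 (l * u\<^sup>2 - l * v\<^sup>2) 0 1 \<in> H"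
    using mult_closed[OF scale[of u] inv_closed[OF scale[of v]]] by simp
  moreover have "l * u\<^sup>2 - l * v\<^sup>2 = x" using uv l by (simp add: field_simps)
  ultimately show "mat2 1 x 0 1 \<in> H" by simp
qed

text \<open>Left and right multiplication by the torus preserves the product of the two diagonal entries, so that product
is an invariant of torus double cosets. Only matrices with both lower entries nonzero are recorded, because for them the class
of \<open>d / c\<close> modulo squares is available to distinguish double cosets.\<close>

definition diag_products :: "'a set" where
  "diag_products = {a * d | a b c d. mat2 a b c d \<in> H \<and> c \<noteq> 0 \<and> d \<noteq> 0}"

text \<open>If \<open>(d / c) / (d' / c')\<close> is the square of \<open>z\<close>, then \<open>M diag(z, 1 / z) M'\<^bsup>-1\<^esup>\<close> is upper triangular, hence
diagonal, so \<open>M\<close> and \<open>M'\<close> lie in the same torus double coset.\<close>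

lemma diag_product_eq:
  assumes diag: "\<forall>e f g. mat2 e f 0 g \<in> H \<longrightarrow> f = 0"
    and M: "mat2 a b c d \<in> H" "c \<noteq> 0" "d \<noteq> 0"
    and M': "mat2 a' b' c' d' \<in> H" "c' \<noteq> 0" "d' \<noteq> 0"
    and z: "(d / c) / (d' / c') = z\<^sup>2"
  shows "a * d = a' * d'"
proof -
  have z0: "z \<noteq> 0" using z M M' by auto
  have zz: "z\<^sup>2 * (c * d') = d * c'" using z M M' by (simp add: field_simps)
  have "mat2 (a * z * d' - b / z * c') (b / z * a' - a * z * b')
          (c * z * d' - d / z * c') (d / z * a' - c * z * b') \<in> H"
    using mult_closed[OF mult_closed[OF M(1) torus[OF z0]] inv_closed[OF M'(1)]]
    by (simp add: divide_inverse algebra_simps)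
  moreover have "c * z * d' - d / z * c' = 0"
    using zz z0 by (simp add: field_simps power2_eq_square)
  ultimately have "b / z * a' - a * z * b' = 0" using diag by metis
  then have "b * a' = z\<^sup>2 * (a * b')" using z0 by (simp add: field_simps power2_eq_square)
  then have "(b * a') * (c * d') = z\<^sup>2 * (c * d') * (a * b')" by simp
  then have "(b * c) * (a' * d') = (a * d) * (b' * c')" unfolding zz by (simp add: mult_ac)
  moreover have "b * c = a * d - 1" "b' * c' = a' * d' - 1"
    using det_eq[OF M(1)] det_eq[OF M'(1)] by (simp_all add: algebra_simps)
  ultimately show ?thesis by (simp add: algebra_simps)
qed

lemma card_diag_products:
  assumes diag: "\<forall>e f g. mat2 e f 0 g \<in> H \<longrightarrow> f = 0"
  shows "card diag_products \<le> 2"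
proof -
  (* The part of the invariants on which d / c is a square, and the part on which it is not. *)
  define S where "S P = {a * d | a b c d. mat2 a b c d \<in> H \<and> c \<noteq> 0 \<and> d \<noteq> 0 \<and> ((\<exists>z. d / c = z\<^sup>2) = P)}" for P
  have "card (S P) \<le> 1" for P
  proof -
    have "x = y" if xy: "x \<in> S P" "y \<in> S P" for x y
    proof -
      obtain a b c d a' b' c' d' where
        M: "mat2 a b c d \<in> H" "c \<noteq> 0" "d \<noteq> 0" "(\<exists>z. d / c = z\<^sup>2) = P" "x = a * d" and
        M': "mat2 a' b' c' d' \<in> H" "c' \<noteq> 0" "d' \<noteq> 0" "(\<exists>z. d' / c' = z\<^sup>2) = P" "y = a' * d'"
        using xy unfolding S_def by blast
      have "\<exists>z. (d / c) / (d' / c') = z\<^sup>2"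
      proof (cases P)
        case True
        then obtain u v where "d / c = u\<^sup>2" "d' / c' = v\<^sup>2" using M(4) M'(4) by auto
        then have "(d / c) / (d' / c') = (u / v)\<^sup>2" by (simp only: power_divide)
        then show ?thesis by blast
      next
        case False
        then show ?thesis using M(4) M'(4) divide_nonsquares_square[of "d / c" "d' / c'"] by blast
      qed
      then show ?thesis using diag_product_eq[OF diag M(1-3) M'(1-3)] M M' by auto
    qed
    then show ?thesis by (metis card_le_Suc0_iff_eq finite One_nat_def)
  qed
  then have "card (S True) + card (S False) \<le> 2" by (metis add_mono one_add_one)
  moreover have "diag_products = S True \<union> S False"
    unfolding diag_products_def S_def by blast
  ultimately show ?thesis by (metis card_Un_le le_trans)
qed

lemma diag_products_eq_char_2:
  assumes diag: "\<forall>e f g. mat2 e f 0 g \<in> H \<longrightarrow> f = 0"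
    and two: "(2 :: 'a) = 0" and xy: "x \<in> diag_products" "y \<in> diag_products"
  shows "x = y"
proof -
  obtain a b c d a' b' c' d' where
    M: "mat2 a b c d \<in> H" "c \<noteq> 0" "d \<noteq> 0" "x = a * d" and
    M': "mat2 a' b' c' d' \<in> H" "c' \<noteq> 0" "d' \<noteq> 0" "y = a' * d'"
    using xy unfolding diag_products_def by blast
  obtain z where "(d / c) / (d' / c') = z\<^sup>2" using square_surj_char_2[OF two] by blast
  from diag_product_eq[OF diag M(1-3) M'(1-3) this] show ?thesis using M M' by simp
qed

lemma torus_conj:
  assumes "mat2 a b c (- a) \<in> H" "t \<noteq> 0"
  shows "mat2 (a\<^sup>2 * t + b * c / t) (a * b * (t - 1 / t)) (a * c * (t - 1 / t)) (b * c * t + a\<^sup>2 / t) \<in> H"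
  using mult_closed[OF mult_closed[OF assms(1) torus[OF assms(2)]] assms(1)]
  by (simp add: power2_eq_square algebra_simps divide_inverse)

text \<open>One involution and the torus together yield many invariants: with \<open>k\<close> the invariant of the matrix
\<open>X = mat2 a b c (- a)\<close>, the products \<open>X diag(t, 1 / t) X\<close> have an invariant that depends on
\<open>t\<^sup>2 + 1 / t\<^sup>2\<close> affinely. The values \<open>0\<close> and \<open>1\<close> account for the products with a vanishing entry in the
lower row.\<close>

lemma conj_diag_product:
  assumes X: "mat2 a b c (- a) \<in> H" "a \<noteq> 0" "c \<noteq> 0" "t \<noteq> 0"
  defines "k \<equiv> - a\<^sup>2"
  defines "k' \<equiv> (k - 1)\<^sup>2 + k\<^sup>2 - k * (k - 1) * (t\<^sup>2 + 1 / t\<^sup>2)"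
  shows "k' \<in> insert 0 (insert 1 diag_products)"
proof -
  have bc: "b * c = k - 1"
    using det_eq[OF X(1)] by (simp add: k_def power2_eq_square algebra_simps)
  have a2: "a\<^sup>2 = - k" by (simp add: k_def)
  note H = torus_conj[OF X(1,4)]
  let ?a = "a\<^sup>2 * t + b * c / t" and ?c = "a * c * (t - 1 / t)" and ?d = "b * c * t + a\<^sup>2 / t"
  have k': "?a * ?d = k'"
    unfolding a2 bc k'_def using X(4) by (simp add: power2_eq_square field_simps)
  show ?thesis
  proof (cases "?c = 0 \<or> ?d = 0")
    case False
    then have "?a * ?d \<in> diag_products" using H unfolding diag_products_def by blast
    then show ?thesis using k' by simp
  next
    case True
    then show ?thesis using k' det_eq[OF H] by auto
  qed
qed

text \<open>The many invariants of the products collide with the few that \<open>H\<close> may have. The map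
\<open>w \<mapsto> w + 1 / w\<close> is at most two-to-one on the nonzero squares \<open>w\<close>, of which there are at least
\<open>(q - 1) / 2\<close>, while all invariants lie among at most \<open>2 + 2\<close> values; so \<open>(q - 1) / 2 \<le> 8\<close>. In
characteristic two every element is a square and there are at most \<open>1 + 2\<close> values, so \<open>q - 1 \<le> 6\<close>.\<close>

lemma card_bound:
  assumes diag: "\<forall>e f g. mat2 e f 0 g \<in> H \<longrightarrow> f = 0"
    and X: "mat2 a b c (- a) \<in> H" "a \<noteq> 0" "b \<noteq> 0" "c \<noteq> 0"
  shows "CARD('a) \<le> 17" "(2 :: 'a) = 0 \<Longrightarrow> CARD('a) \<le> 7"
proof -
  define k where "k = - a\<^sup>2"
  define f where "f w = (k - 1)\<^sup>2 + k\<^sup>2 - k * (k - 1) * (w + 1 / w)" for w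
  define Q :: "'a set" where "Q = (\<lambda>t. t\<^sup>2) ` (UNIV - {0})"
  have "b * c = k - 1"
    using det_eq[OF X(1)] by (simp add: k_def power2_eq_square algebra_simps)
  then have k: "k * (k - 1) \<noteq> 0" using X by (auto simp: k_def)
  have "card {w \<in> Q. f w = y} \<le> 2" for y
  proof (cases "{w \<in> Q. f w = y} = {}")
    case True
    show ?thesis unfolding True by simp
  next
    case False
    then obtain u where u: "u \<in> Q" "f u = y" by blast
    show ?thesis
    proof (rule card_le_2_if_two_values[of _ u "1 / u"])
      fix w assume "w \<in> {w \<in> Q. f w = y}"
      then have w: "w \<in> Q" "f w = f u" using u by auto
      then have "w + 1 / w = u + 1 / u" using k by (simp add: f_def)
      moreover have "w \<noteq> 0" "u \<noteq> 0" using u w by (auto simp: Q_def)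
      ultimately have "(w - u) * (w * u - 1) = 0" by (simp add: field_simps)
      then have "w = u \<or> w * u = 1" by simp
      then show "w = u \<or> w = 1 / u" using \<open>u \<noteq> 0\<close> by (simp add: eq_divide_eq)
    qed
  qed
  then have "card Q \<le> 2 * card (f ` Q)" by (intro card_le_twice_card_image) auto
  also have "card (f ` Q) \<le> card (insert 0 (insert 1 diag_products))"
    using conj_diag_product[OF X(1,2,4)]
    by (intro card_mono) (auto simp: Q_def f_def k_def)
  also have "\<dots> \<le> card diag_products + 2"
    by (metis (no_types, lifting) Suc_le_mono add_2_eq_Suc' card_insert_le_m1 card_insert_if finite le_SucI order_refl)
  finally have Q: "card Q \<le> 2 * (card diag_products + 2)" by simp
  have "card (UNIV - {0 :: 'a}) \<le> 2 * card Q"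
    unfolding Q_def
  proof (rule card_le_twice_card_image)
    fix y :: 'a
    show "card {x \<in> UNIV - {0}. x\<^sup>2 = y} \<le> 2"
    proof (cases "\<exists>u. u\<^sup>2 = y")
      case True
      then obtain u where "u\<^sup>2 = y" by blast
      then show ?thesis by (intro card_le_2_if_two_values[of _ u "- u"]) (auto simp: power2_eq_iff)
    qed auto
  qed auto
  with Q card_diag_products[OF diag] show "CARD('a) \<le> 17" by (simp add: card_Diff_singleton)
  assume two: "(2 :: 'a) = 0"
  have "Q = UNIV - {0}"
  proof
    show "Q \<subseteq> UNIV - {0}" by (auto simp: Q_def)
    show "UNIV - {0} \<subseteq> Q" using square_surj_char_2[OF two] by (force simp: Q_def)
  qed
  then have "CARD('a) - 1 = card Q" by (simp add: card_Diff_singleton)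
  moreover have "card diag_products \<le> 1"
    using diag_products_eq_char_2[OF diag two] by (metis card_le_Suc0_iff_eq finite One_nat_def)
  ultimately show "CARD('a) \<le> 7" using Q by simp
qed

text \<open>This settles the field with four elements, where \<open>s\<close> is a primitive cube root of unity and can itself serve as the torus
parameter: \<open>X diag(s, 1 / s) X\<close> has diagonal \<open>0, 1\<close>, which adds the invariant \<open>0\<close> to the nonzero
invariant of \<open>X\<close>, whereas only one is possible.\<close>

lemma not_diagonal_order_4:
  assumes diag: "\<forall>e f g. mat2 e f 0 g \<in> H \<longrightarrow> f = 0"
    and X: "mat2 a b c (- a) \<in> H" "a \<noteq> 0" "c \<noteq> 0"
    and two: "(2 :: 'a) = 0" and s: "s\<^sup>2 + s = 1" "a\<^sup>2 = s\<^sup>2"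
  shows False
proof -
  have neg: "- x = x" for x :: 'a
    using two by (metis add.inverse_unique mult_2 mult_zero_left)
  have s2: "s\<^sup>2 = s + 1" using s(1) neg by (metis add.commute add_diff_cancel_left' uminus_add_conv_diff)
  have s0: "s \<noteq> 0" using s2 by auto
  have inv: "1 / s = s + 1" using s(1) s0 by (simp add: field_simps power2_eq_square)
  have "b * c = - (a\<^sup>2 + 1)"
    using det_eq[OF X(1)] by (simp add: power2_eq_square algebra_simps)
  then have bc: "b * c = s" unfolding neg s(2) s2 using two by simp
  have "(a * c) * (s - 1 / s) \<noteq> 0" using X inv by simp
  moreover have d: "b * c * s + a\<^sup>2 / s = 1"
    using s s0 unfolding bc s(2) by (simp add: power2_eq_square)
  moreover have "a\<^sup>2 * s + b * c / s = 0"
  proof -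
    have "a\<^sup>2 * s + b * c / s = (s + 1) * s + 1"
      unfolding bc s(2) s2 using s0 by simp
    also have "\<dots> = s\<^sup>2 + s + 1" by (simp add: power2_eq_square algebra_simps)
    finally show ?thesis using s(1) two by simp
  qed
  ultimately have "0 \<in> diag_products"
    using torus_conj[OF X(1) s0] unfolding diag_products_def by force
  moreover have "a * (- a) \<in> diag_products"
    using X unfolding diag_products_def by (intro CollectI exI[of _ a] exI[of _ b] exI[of _ c] exI[of _ "- a"]) auto
  ultimately have "0 = a * (- a)" by (rule diag_products_eq_char_2[OF diag two])
  then show False using X by simp
qed

text \<open>This settles the field with nine elements. The invariant \<open>k\<close> of \<open>X\<close> is a square root of \<open>- 1\<close>. The
parameters \<open>w\<close> and \<open>w\<^sup>2\<close> have \<open>t\<^sup>2 + 1 / t\<^sup>2\<close> equal to \<open>0\<close> and \<open>1\<close>, and give the invariants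
\<open>k - 1\<close> and \<open>- k\<close>. Together with \<open>k\<close> these are three, whereas at most two are possible.\<close>

lemma not_diagonal_order_9:
  assumes diag: "\<forall>e f g. mat2 e f 0 g \<in> H \<longrightarrow> f = 0"
    and X: "mat2 a b c (- a) \<in> H" "a \<noteq> 0" "c \<noteq> 0"
    and three: "(3 :: 'a) = 0" and s: "s\<^sup>2 + s = 1" "a\<^sup>2 = s\<^sup>2"
    and w: "(w :: 'a) ^ 4 = - 1"
  shows False
proof -
  have w0: "w \<noteq> 0" using w by auto
  have two: "(2 :: 'a) = - 1" using three by (simp add: eq_neg_iff_add_eq_0)
  have two0: "(2 :: 'a) \<noteq> 0" by (simp add: two)
  define k where "k = - a\<^sup>2"
  have ks: "k = s - 1" using s by (simp add: k_def algebra_simps)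
  have k2: "k\<^sup>2 = - 1"
  proof -
    have "k\<^sup>2 + 1 = s\<^sup>2 + s - 1 + (1 - s) * 3" by (simp add: ks power2_eq_square algebra_simps)
    then show ?thesis using s(1) three by (simp add: eq_neg_iff_add_eq_0)
  qed
  have inv2: "1 / w\<^sup>2 = - w\<^sup>2" using w w0 by (simp add: field_simps power4_eq_xxxx power2_eq_square)
  have inv4: "(w\<^sup>2)\<^sup>2 = - 1" "1 / (w\<^sup>2)\<^sup>2 = - 1" using w by (simp_all flip: power_mult)
  have "(k - 1)\<^sup>2 + k\<^sup>2 - k * (k - 1) * (w\<^sup>2 + 1 / w\<^sup>2) = k - 1"
  proof -
    have "(k - 1)\<^sup>2 + k\<^sup>2 - (k - 1) = 2 * (k\<^sup>2 + 1) - 3 * k"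
      by (simp add: power2_eq_square algebra_simps)
    then show ?thesis unfolding inv2 using k2 three by simp
  qed
  then have k1: "k - 1 \<in> insert 0 (insert 1 diag_products)"
    using conj_diag_product[OF X w0] unfolding k_def by simp
  have "(k - 1)\<^sup>2 + k\<^sup>2 - k * (k - 1) * ((w\<^sup>2)\<^sup>2 + 1 / (w\<^sup>2)\<^sup>2) = - k"
  proof -
    have "(k - 1)\<^sup>2 + k\<^sup>2 - k * (k - 1) * (- 1 + - 1) + k = 4 * (k\<^sup>2 + 1) - 3 - 3 * k"
      by (simp add: power2_eq_square algebra_simps)
    also have "\<dots> = 0" using k2 three by simp
    finally show ?thesis unfolding inv4(2) unfolding inv4(1) by (simp only: eq_neg_iff_add_eq_0)
  qed
  then have mk: "- k \<in> insert 0 (insert 1 diag_products)"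
    using conj_diag_product[OF X, of "w\<^sup>2"] w0 unfolding k_def by simp
  have k: "a * (- a) \<in> diag_products"
    using X unfolding diag_products_def by (intro CollectI exI[of _ a] exI[of _ b] exI[of _ c] exI[of _ "- a"]) auto
  have ne: "k \<noteq> 0" "k \<noteq> 1" "k \<noteq> - 1"
  proof -
    have one: "(1 :: 'a) \<noteq> - 1" using two0 by (metis add.right_inverse one_add_one)
    show "k \<noteq> 0" "k \<noteq> 1" "k \<noteq> - 1" using k2 one by auto
  qed
  have "{k, - k, k - 1} \<subseteq> diag_products"
  proof -
    have "k - 1 \<noteq> 1" using ne(3) two by (metis add_diff_cancel diff_add_cancel one_add_one)
    moreover have "- k \<noteq> 1" using ne(3) by (metis minus_minus)
    ultimately show ?thesis using k1 mk k ne by (auto simp: k_def power2_eq_square)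
  qed
  moreover have "card {k, - k, k - 1} = 3"
  proof -
    have "k \<noteq> - k"
    proof
      assume "k = - k"
      then have "2 * k = 0" by (metis add.right_inverse mult_2)
      then show False using two0 ne(1) by simp
    qed
    moreover have "- k \<noteq> k - 1"
    proof
      assume "- k = k - 1"
      then have "2 * k = 1" by (simp add: algebra_simps)
      then show False using ne(3) unfolding two by (metis minus_minus mult_minus1)
    qed
    ultimately show ?thesis by simp
  qed
  ultimately have "3 \<le> card diag_products" by (metis card_mono finite)
  then show False using card_diag_products[OF diag] by simp
qed

end

section \<open>Passage to the projective group\<close>

lemma (in normal) Mod_hom: "group_hom G (G Mod H) (\<lambda>g. H #> g)"
  by (simp add: group_hom_def group_hom_axioms_def factorgroup_is_group r_coset_hom_Mod is_group)

lemma ord_PSL2_prime: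
  fixes g :: "'a::field ^ 2 ^ 2"
  assumes "prime n" and g: "g \<in> carrier SL2" "g \<notin> centre SL2" "g [^]\<^bsub>SL2\<^esub> n \<in> centre SL2"
  shows "group.ord PSL2 (centre SL2 #>\<^bsub>SL2\<^esub> g) = n"
proof -
  interpret N: normal "centre SL2" "SL2 :: ('a ^ 2 ^ 2) monoid"
    by (intro centre_normal group_SL2)
  interpret P: group "PSL2 :: ('a ^ 2 ^ 2) set monoid" by (rule group_PSL2)
  interpret h: group_hom SL2 PSL2 "\<lambda>g :: 'a ^ 2 ^ 2. centre SL2 #>\<^bsub>SL2\<^esub> g"
    using N.Mod_hom by (simp add: PSL2_def)
  have one: "(centre SL2 #>\<^bsub>SL2\<^esub> x = \<one>\<^bsub>PSL2\<^esub>) = (x \<in> centre SL2)" if "x \<in> carrier SL2" for x :: "'a ^ 2 ^ 2"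
    using that N.coset_join1[OF _ that N.subgroup_axioms] N.coset_join2[OF that N.subgroup_axioms]
    by (auto simp: PSL2_def FactGroup_def)
  have "(centre SL2 #>\<^bsub>SL2\<^esub> g) [^]\<^bsub>PSL2\<^esub> n = \<one>\<^bsub>PSL2\<^esub>"
    using g(3) one[OF N.nat_pow_closed[OF g(1)]] h.hom_nat_pow[OF g(1), of n] by metis
  then have "P.ord (centre SL2 #>\<^bsub>SL2\<^esub> g) dvd n"
    using P.pow_eq_id[OF h.hom_closed[OF g(1)]] by simp
  moreover have "P.ord (centre SL2 #>\<^bsub>SL2\<^esub> g) \<noteq> 1"
    using P.ord_eq_1[OF h.hom_closed[OF g(1)]] one[OF g(1)] g(2) by simp
  ultimately show ?thesis using assms(1) prime_nat_iff by blast
qed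

text \<open>A matrix of trace \<open>0\<close> and determinant \<open>1\<close> squares to \<open>- 1\<close>, so it becomes an involution modulo the centre.\<close>

lemma two_generated_PSL2I:
  fixes a :: "'a::field"
  assumes p: "prime p"
    and X: "X = mat2 a b c (- a)" "X \<in> carrier SL2" "c \<noteq> 0"
    and Y: "Y = mat2 a' b' c' d'" "Y \<in> carrier SL2" "b' \<noteq> 0"
    and tr: "cheb (a' + d') p = 0" "cheb (a' + d') (p - 1) = - 1"
    and gen: "generate SL2 {X, Y} = carrier SL2"
  shows "two_generated (PSL2 :: ('a ^ 2 ^ 2) set monoid) 2 p"
proof -
  interpret N: normal "centre SL2" "SL2 :: ('a ^ 2 ^ 2) monoid"
    by (intro centre_normal group_SL2)
  interpret P: group "PSL2 :: ('a ^ 2 ^ 2) set monoid" by (rule group_PSL2)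
  let ?h = "\<lambda>g :: 'a ^ 2 ^ 2. centre SL2 #>\<^bsub>SL2\<^esub> g"
  interpret h: group_hom SL2 PSL2 ?h
    using N.Mod_hom by (simp add: PSL2_def)
  have "a * a + b * c = - (- (a * a) - b * c)" by simp
  also have "- (a * a) - b * c = 1" using X by simp
  finally have "X [^]\<^bsub>SL2\<^esub> (2 :: nat) = mat2 (- 1) 0 0 (- 1)"
    using X by (simp add: eval_nat_numeral one_SL2 mult.commute add.commute)
  then have X2: "X [^]\<^bsub>SL2\<^esub> (2 :: nat) \<in> centre SL2"
    by (simp add: mem_centre_SL2_iff mat_1_eq_mat2 uminus_mat2)
  have "Y [^]\<^bsub>SL2\<^esub> p = \<one>\<^bsub>SL2\<^esub>"
    using SL2_pow_eq_one_iff[of a' d' b' c' p] Y tr p prime_gt_0_nat by auto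
  then have Yp: "Y [^]\<^bsub>SL2\<^esub> p \<in> centre SL2" by simp
  have nc: "X \<notin> centre SL2" "Y \<notin> centre SL2"
    using X Y by (auto simp: mem_centre_SL2_iff mat_1_eq_mat2 uminus_mat2)
  have "generate PSL2 (?h ` {X, Y}) = ?h ` carrier SL2"
    using h.generate_img[of "{X, Y}"] X Y gen by simp
  also have "\<dots> = carrier PSL2" by (auto simp: PSL2_def FactGroup_def RCOSETS_def)
  finally have "generate PSL2 {?h X, ?h Y} = carrier PSL2" by simp
  moreover have "P.ord (?h X) = 2" "P.ord (?h Y) = p"
    using ord_PSL2_prime[OF two_is_prime_nat X(2) nc(1) X2] ord_PSL2_prime[OF p Y(2) nc(2) Yp] by simp_all
  ultimately show ?thesis
    unfolding two_generated_def using h.hom_closed X(2) Y(2) by blast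
qed

lemma order_PSL2_dvd: "order (PSL2 :: ('a::{field, finite} ^ 2 ^ 2) set monoid) dvd order (SL2 :: ('a ^ 2 ^ 2) monoid)"
proof -
  interpret N: normal "centre SL2" "SL2 :: ('a ^ 2 ^ 2) monoid"
    by (intro centre_normal group_SL2)
  show ?thesis
    using N.lagrange[OF N.is_subgroup] 
    by (metis PSL2_def FactGroup_def order_def dvd_triv_left partial_object.select_convs(1))
qed

section \<open>Generating pairs\<close>

text \<open>Over a prime field a single transvection generates all upper unipotents, so the generators are chosen
with a transvection as their quotient.\<close>

lemma two_generated_prime_field:
  assumes p: "prime p" "p \<ge> 5" "p dvd order (SL2 :: ('a ^ 2 ^ 2) monoid)"
    and prime: "prime CARD('a::{field, finite})"
  shows "two_generated (PSL2 :: ('a ^ 2 ^ 2) set monoid) 2 p"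
proof -
  interpret group "SL2 :: ('a ^ 2 ^ 2) monoid" by (rule group_SL2)
  (* Any value other than 4 serves as the one that the square of the trace avoids. *)
  have "(5 :: 'a) - 4 \<noteq> 0" by simp
  then have five: "(5 :: 'a) \<noteq> 4" by (metis diff_self)
  obtain s :: 'a where s: "s \<noteq> 0" "cheb s p = 0" "cheb s (p - 1) = - 1"
    using exists_trace_of_order[OF p five] by blast
  define X Y where "X = mat2 0 (- inverse s) s (- 0)" and "Y = mat2 s (- inverse s) s 0"
  define H where "H = generate SL2 {X, Y}"
  have XY: "X \<in> carrier SL2" "Y \<in> carrier SL2" using s by (simp_all add: X_def Y_def)
  have H: "subgroup H SL2" unfolding H_def using XY by (intro generate_is_subgroup) auto
  have X: "mat2 0 (- inverse s) s 0 \<in> H" and Y: "mat2 s (- inverse s) s 0 \<in> H"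
    unfolding H_def X_def Y_def by (auto intro: generate.incl)
  have U: "mat2 1 1 0 1 \<in> H"
    using subgroup_SL2_mult[OF H Y subgroup_SL2_inv[OF H X]] s by simp
  have Un: "mat2 1 (of_nat n) 0 1 \<in> H" for n
  proof (induction n)
    case 0
    show ?case using subgroup.one_closed[OF H] by (simp add: one_SL2)
  next
    case (Suc n)
    show ?case using subgroup_SL2_mult[OF H Suc.IH U] by simp
  qed
  have "H = carrier SL2"
    using SL2_eq_if_upper_unipotents[OF H _ X s(1)] Un prime_field_of_nat[OF prime] by metis
  then show ?thesis
    using two_generated_PSL2I[OF p(1) X_def XY(1) s(1) Y_def XY(2)] s by (simp add: H_def)
qed

lemma small_nonprime_primepow:
  fixes q :: nat
  assumes "primepow q" "\<not> prime q" "q \<ge> 4" "q \<le> 17"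
  shows "q \<in> {4, 8, 9, 16}"
proof -
  obtain r k where r: "prime r" "q = r ^ k" using assms(1) by (auto simp: primepow_def)
  (* Excludes the orders 6, 10, 12, 14 and 15 that have two prime divisors. *)
  have uniq: "u = v" if "prime u" "prime v" "u dvd q" "v dvd q" for u v
    using that r by (metis prime_dvd_power primes_dvd_imp_eq)
  have "q = 4 \<or> q = 5 \<or> q = 6 \<or> q = 7 \<or> q = 8 \<or> q = 9 \<or> q = 10 \<or> q = 11 \<or>
      q = 12 \<or> q = 13 \<or> q = 14 \<or> q = 15 \<or> q = 16 \<or> q = 17"
    using assms(3,4) by presburger
  then show ?thesis using assms(2) uniq[of 2 3] uniq[of 2 5] uniq[of 2 7] uniq[of 3 5] by auto
qed

lemma prime_eq_5_if_dvd:
  fixes p :: nat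
  assumes "prime p" "p \<ge> 5" "p dvd q * (q - 1) * (q + 1)" "q \<in> {4, 9}"
  shows "p = 5"
proof -
  (* The product is 60 for q = 4 and 720 for q = 9. *)
  have "p dvd 2 ^ 4 * 3 ^ 2 * 5" if "p dvd 60 \<or> p dvd 720"
    using that dvd_trans[of p 60 720] by auto
  then have "p dvd 2 ^ 4 * 3 ^ 2 * 5" using assms(3,4) by auto
  then have "p dvd 2 \<or> p dvd 3 \<or> p dvd 5"
    using assms(1) by (auto simp: prime_dvd_mult_iff prime_dvd_power_iff simp del: power_numeral)
  then show ?thesis using assms(2) by (auto dest: dvd_imp_le)
qed

text \<open>The generators are chosen so that \<open>X\<^bsup>-1\<^esup> Y\<close> is the diagonal matrix of a primitive element \<open>w\<close>; then \<open>H\<close>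
contains the whole torus. The trace \<open>s\<close> of \<open>Y\<close> fixes the entry \<open>a = s / (w - 1 / w)\<close> of \<open>X\<close>, and the
requirement that \<open>X\<close> be not triangular, \<open>a\<^sup>2 \<noteq> - 1\<close>, reads \<open>s\<^sup>2 + t\<^sup>2 \<noteq> 4\<close> with
\<open>t = w + 1 / w\<close>.\<close>

lemma two_generated_nonprime_field:
  assumes p: "prime p" "p \<ge> 5" "p dvd order (SL2 :: ('a ^ 2 ^ 2) monoid)"
    and q: "primepow CARD('a::{field, finite})" "\<not> prime CARD('a)" "CARD('a) \<ge> 4"
  shows "two_generated (PSL2 :: ('a ^ 2 ^ 2) set monoid) 2 p"
proof -
  interpret group "SL2 :: ('a ^ 2 ^ 2) monoid" by (rule group_SL2)
  obtain w :: 'a where w: "w \<noteq> 0" "\<And>x. x \<noteq> 0 \<Longrightarrow> \<exists>n::nat. x = w ^ n"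
    using finite_field_primitive_element by blast
  note small = CARD_le_if_power_eq_one[OF w(2)]
  define t where "t = w + 1 / w"
  define e where "e = w - 1 / w"
  have e2: "e\<^sup>2 = t\<^sup>2 - 4" using w(1) by (simp add: e_def t_def power2_eq_square field_simps)
  have two_if_4: "(2 :: 'a) = 0" if "CARD('a) \<in> {4, 8, 16}"
  proof -
    have "(2 :: 'a) ^ 2 = 0 \<or> (2 :: 'a) ^ 3 = 0 \<or> (2 :: 'a) ^ 4 = 0"
      using that of_nat_CARD[where ?'a = 'a] by auto
    then show ?thesis by (metis power_eq_0_iff)
  qed
  (* A primitive element of small order would make the field too small. *)
  have w2: "w\<^sup>2 \<noteq> 1" using small[of 2] q(3) by auto
  then have e0: "e \<noteq> 0" using w(1) by (auto simp: e_def field_simps power2_eq_square)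
  have w4: "w ^ 4 \<noteq> 1" if "CARD('a) \<noteq> 4"
    using small[of 4] q that by (cases "CARD('a) = 5") auto
  have t0: "t \<noteq> 0"
  proof
    assume "t = 0"
    then have w2': "w\<^sup>2 = - 1" using w(1) by (simp add: t_def field_simps power2_eq_square add_eq_0_iff)
    then have "w ^ 4 = 1" by (metis mult_2 numeral_Bit0 power2_minus power_mult one_power2)
    then have "(2 :: 'a) = 0" using w4 two_if_4 by auto
    then have "w\<^sup>2 = 1" using w2' by (metis add.inverse_unique one_add_one)
    then show False using w2 by simp
  qed
  (* Avoiding this value for s\<^sup>2 is what keeps X from being triangular. *)
  then have "4 - t\<^sup>2 \<noteq> 4" by simp
  from exists_trace_of_order[OF p this] obtain s :: 'a
    where s: "s \<noteq> 0" "s\<^sup>2 \<noteq> 4 - t\<^sup>2" "cheb s p = 0" "cheb s (p - 1) = - 1" .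
  define a where "a = s / e"
  define c where "c = - 1 - a\<^sup>2"
  have a0: "a \<noteq> 0" using s(1) e0 by (simp add: a_def)
  have c0: "c \<noteq> 0"
  proof
    assume "c = 0"
    then have "a\<^sup>2 = - 1" by (simp add: c_def algebra_simps)
    then have "s\<^sup>2 = - (e\<^sup>2)" using e0 by (simp add: a_def power_divide field_simps)
    then show False using s(2) e2 by simp
  qed
  define X where "X = mat2 a 1 c (- a)"
  define Y where "Y = mat2 (a * w) (1 / w) (c * w) (- a / w)"
  define H where "H = generate SL2 {X, Y}"
  have XY: "X \<in> carrier SL2" "Y \<in> carrier SL2"
    using w(1) by (simp_all add: X_def Y_def c_def power2_eq_square)
  have H: "subgroup H SL2" unfolding H_def using XY by (intro generate_is_subgroup) auto
  have X: "mat2 a 1 c (- a) \<in> H" and Y: "mat2 (a * w) (1 / w) (c * w) (- a / w) \<in> H"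
    unfolding H_def X_def Y_def by (auto intro: generate.incl)
  have D: "mat2 w 0 0 (inverse w) \<in> H"
    using subgroup_SL2_mult[OF H subgroup_SL2_inv[OF H X] Y] w(1)
    by (simp add: c_def power2_eq_square field_simps)
  have Dn: "mat2 (w ^ n) 0 0 (inverse (w ^ n)) \<in> H" for n
  proof (induction n)
    case 0
    show ?case using subgroup.one_closed[OF H] by (simp add: one_SL2)
  next
    case (Suc n)
    show ?case using subgroup_SL2_mult[OF H D Suc.IH] by (simp add: inverse_mult_distrib mult.commute)
  qed
  have "mat2 x 0 0 (inverse x) \<in> H" if "x \<noteq> 0" for x using w(2)[OF that] Dn by metis
  with H interpret torus_overgroup H by (rule torus_overgroup.intro)
  have "H = carrier SL2"
  proof (rule ccontr)
    assume "H \<noteq> carrier SL2"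
    then have diag: "\<forall>e f g. mat2 e f 0 g \<in> H \<longrightarrow> f = 0"
      using eq_carrier_if_nondiagonal_upper[OF X c0] by blast
    note bound = card_bound[OF diag X a0 one_neq_zero c0]
    then have "CARD('a) \<in> {4, 8, 9, 16}" using small_nonprime_primepow q by blast
    (* Orders 8 and 16 are excluded by the sharper bound in characteristic two. *)
    then have q49: "CARD('a) \<in> {4, 9}" using bound(2) two_if_4 by auto
    then have p5: "p = 5" using prime_eq_5_if_dvd p by (metis order_SL2)
    have golden: "s\<^sup>2 + s = 1" using s p5 by (intro cheb_5_golden) auto
    show False
    proof (cases "CARD('a) = 4")
      case True
      then have two: "(2 :: 'a) = 0" using two_if_4 by simp
      (* In this case w - 1 / w = 1. *)
      have "w ^ 3 = 1" using power_CARD_minus_one[OF w(1)] True by simp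
      moreover have "w ^ 3 - 1 = (w - 1) * (w\<^sup>2 + w + 1)"
        by (simp add: power2_eq_square power3_eq_cube algebra_simps)
      moreover have "w \<noteq> 1" using w2 by auto
      ultimately have "w\<^sup>2 + w + 1 = 0" by simp
      moreover have "w * (- w - 1) = 1 - (w\<^sup>2 + w + 1)" by (simp add: power2_eq_square algebra_simps)
      ultimately have "w * (- w - 1) = 1" by simp
      then have "1 / w = - w - 1" using w(1) by (metis nonzero_mult_div_cancel_left)
      then have "e = 2 * w + 1" by (simp add: e_def)
      then have "a\<^sup>2 = s\<^sup>2" using two by (simp add: a_def)
      then show False using not_diagonal_order_4[OF diag X a0 c0 two golden] by simp
    next
      case False
      then have nine: "CARD('a) = 9" using q49 by simp
      (* In this case w ^ 4 = - 1, and (w - 1 / w)\<^sup>2 = - 2 = 1. *)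
      have "(3 :: 'a) * 3 = 0" using of_nat_CARD[where ?'a = 'a] nine by simp
      then have three: "(3 :: 'a) = 0" by (metis mult_eq_0_iff)
      have "w ^ 8 = 1" using power_CARD_minus_one[OF w(1)] nine by simp
      moreover have "w ^ 8 - 1 = (w ^ 4 - 1) * (w ^ 4 + 1)"
        by (simp add: algebra_simps flip: power_add)
      ultimately have "w ^ 4 + 1 = 0" using w4 nine by simp
      then have w4': "w ^ 4 = - 1" by (simp add: eq_neg_iff_add_eq_0)
      have "e\<^sup>2 * w\<^sup>2 = w ^ 4 + 1 - 3 * w\<^sup>2 + w\<^sup>2"
        using w(1) by (simp add: e_def power2_eq_square power4_eq_xxxx field_simps)
      then have "e\<^sup>2 * w\<^sup>2 = w\<^sup>2" using w4' three by simp
      then have "e\<^sup>2 = 1" using w(1) by simp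
      then have "a\<^sup>2 = s\<^sup>2" by (simp add: a_def power_divide)
      then show False using not_diagonal_order_9[OF diag X a0 c0 three golden _ w4'] by simp
    qed
  qed
  moreover have "a * w + - a / w = a * e" by (simp add: e_def algebra_simps)
  then have "a * w + - a / w = s" using e0 by (simp add: a_def)
  ultimately show ?thesis
    using two_generated_PSL2I[OF p(1) X_def XY(1) c0 Y_def XY(2)] w(1) s(3,4) by (simp add: H_def)
qed

theorem theorem1p1:
  fixes p q :: nat
  assumes "prime p" and "p \<ge> 5"
    and "primepow q" and "q \<ge> 4"
    and "CARD('a::{field, finite}) = q"
  shows "two_generated (PSL2 :: ('a ^ 2 ^ 2) set monoid) 2 p \<longleftrightarrow>
           [int q = 0] (mod int p) \<or> [int q = 1] (mod int p) \<or> [int q = - 1] (mod int p)"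
proof -
  have "two_generated (PSL2 :: ('a ^ 2 ^ 2) set monoid) 2 p \<longleftrightarrow>
      p dvd order (SL2 :: ('a ^ 2 ^ 2) monoid)" (is "?gen \<longleftrightarrow> ?dvd")
  proof
    assume ?gen
    then have "p dvd order (PSL2 :: ('a ^ 2 ^ 2) set monoid)"
      unfolding two_generated_def using group.ord_dvd_group_order[OF group_PSL2] by metis
    then show ?dvd using order_PSL2_dvd dvd_trans by blast
  next
    assume ?dvd
    then show ?gen
      using two_generated_prime_field two_generated_nonprime_field assms by blast
  qed
  also have "\<dots> \<longleftrightarrow> p dvd q \<or> p dvd q - 1 \<or> p dvd q + 1"
    by (simp only: order_SL2 assms(5) prime_dvd_mult_iff[OF assms(1)] disj_assoc)
  also have "\<dots> \<longleftrightarrow> int p dvd int q \<or> int p dvd int q - 1 \<or> int p dvd int q + 1"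
  proof -
    have "int q - 1 = int (q - 1)" "int q + 1 = int (q + 1)" using assms(4) by auto
    then show ?thesis by (simp only: int_dvd_int_iff)
  qed
  also have "\<dots> \<longleftrightarrow> [int q = 0] (mod int p) \<or> [int q = 1] (mod int p) \<or> [int q = - 1] (mod int p)"
    by (simp add: cong_iff_dvd_diff)
  finally show ?thesis .
qed

end
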